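(* Let $f_X$ and $f_Y$ be probability density functions on $(0,\infty)$ with finite means $E(X)$ and $E(Y)$ and Laplace transforms $f_X^*(s)=\int_0^\infty e^{-st}f_X(t)\,dt$, $f_Y^*(s)=\int_0^\infty e^{-st}f_Y(t)\,dt$. Let $P_{OFF,OFF}(\Delta t)$, $P_{ON,ON}(\Delta t)$ and $P_{ON,OFF}(\Delta t)$ be the conditional channel-state probabilities defined in the context for the ON-OFF process with ON-time density $f_X$ and OFF-time density $f_Y$. Then for every $s>0$ their Laplace transforms in $\Delta t$ are $$P_{OFF,OFF}^*(s)=\frac1s-\frac{(1-f_Y^*(s))(1-f_X^*(s))}{s^2E(Y)\,(1-f_X^*(s)f_Y^*(s))},$$ $$P_{ON,ON}^*(s)=\frac1s-\frac{(1-f_Y^*(s))(1-f_X^*(s))}{s^2E(X)\,(1-f_X^*(s)f_Y^*(s))},\qquad P_{ON,OFF}^*(s)=\frac1s-P_{ON,ON}^*(s).$$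
   Context: A channel alternates between OFF periods (channel idle, free from the primary user) and ON periods (channel occupied). OFF durations have density $f_Y$, ON durations have density $f_X$, and all durations are mutually independent. The channel is sensed at a time $t_0$; the elapsed time since sensing is $\Delta t\ge0$. If the channel is OFF at $t_0$, the remaining OFF time $Y_R$ has density $f_{Y_R}(r)=\Pr(Y\ge r)/E(Y)$, $r>0$, where $Y\sim f_Y$; it is followed by independent periods $X_1,Y_2,X_2,Y_3,\dots$ (alternately ON and OFF) with $X_i\sim f_X$, $Y_i\sim f_Y$. $P_{OFF,OFF}(\Delta t)$ is the probability that the channel is OFF at time $t_0+\Delta t$ in this situation. Symmetrically, if the channel is ON at $t_0$, the remaining ON time $X_R$ has density $\Pr(X\ge r)/E(X)$, where $X\sim f_X$, and is followed by independent alternating OFF and ON periods with densities $f_Y$ and $f_X$. $P_{ON,ON}(\Delta t)$ and $P_{ON,OFF}(\Delta t)$ are the probabilities that the channel is ON, respectively OFF, at time $t_0+\Delta t$ in this situation. For a function $P(\Delta t)$, $P^*(s)=\int_0^\infty e^{-su}P(u)\,du$. *)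

theory Defs
  imports "HOL-Probability.Probability"
begin

text \<open>A density on \<open>(0, \<infinity>)\<close> is represented by its extension by zero to the real line.\<close>

definition pos_density :: "(real \<Rightarrow> real) \<Rightarrow> bool" where
  "pos_density f \<longleftrightarrow>
     (\<forall>x. 0 \<le> f x) \<and> (\<forall>x\<le>0. f x = 0) \<and> has_bochner_integral lborel f 1"

definition finite_mean :: "(real \<Rightarrow> real) \<Rightarrow> bool" where
  "finite_mean f \<longleftrightarrow> set_integrable lborel {0..} (\<lambda>t. t * f t)"

definition mean :: "(real \<Rightarrow> real) \<Rightarrow> real" where
  "mean f = (LBINT t:{0..}. t * f t)"

definition laplace :: "(real \<Rightarrow> real) \<Rightarrow> real \<Rightarrow> real" where
  "laplace f s = (LBINT t:{0..}. exp (- s * t) * f t)"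

text \<open>The density of the remaining lifetime: \<open>Pr(T \<ge> r) / E(T)\<close> for \<open>r > 0\<close>,
  where \<open>T\<close> has density \<open>f\<close>.\<close>

definition residual_density :: "(real \<Rightarrow> real) \<Rightarrow> real \<Rightarrow> real" where
  "residual_density f r =
     (if 0 < r then measure (density lborel (\<lambda>t. ennreal (f t))) {r..} / mean f else 0)"

text \<open>The durations of the successive periods counted from the sensing time: period \<open>0\<close> is the
  remainder of the period in progress, whose full duration has density \<open>f\<close>; the periods with odd
  index are those of the opposite state, with density \<open>g\<close>.\<close>

definition alternating_durations ::
    "'a measure \<Rightarrow> (nat \<Rightarrow> 'a \<Rightarrow> real) \<Rightarrow> (real \<Rightarrow> real) \<Rightarrow> (real \<Rightarrow> real) \<Rightarrow> bool" where
  "alternating_durations M D f g \<longleftrightarrow>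
     prob_space M \<and>
     prob_space.indep_vars M (\<lambda>_. borel) D UNIV \<and>
     distributed M lborel (D 0) (\<lambda>x. ennreal (residual_density f x)) \<and>
     (\<forall>n. distributed M lborel (D (2 * n + 1)) (\<lambda>x. ennreal (g x))) \<and>
     (\<forall>n. distributed M lborel (D (2 * n + 2)) (\<lambda>x. ennreal (f x)))"

datatype channel_state = OFF | ON

fun opposite :: "channel_state \<Rightarrow> channel_state" where
  "opposite OFF = ON"
| "opposite ON = OFF"

definition period_state :: "channel_state \<Rightarrow> nat \<Rightarrow> channel_state" where
  "period_state i n = (if even n then i else opposite i)"

text \<open>The probability that the channel, being in state \<open>i\<close> at the sensing time and having
  subsequent period durations \<open>D 0, D 1, \<dots>\<close>, is in state \<open>j\<close> when time \<open>u\<close> has elapsed.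
  Period \<open>n\<close> occupies the half-open interval from \<open>D 0 + \<dots> + D (n - 1)\<close>
  to \<open>D 0 + \<dots> + D n\<close>.\<close>

definition channel_prob ::
    "'a measure \<Rightarrow> (nat \<Rightarrow> 'a \<Rightarrow> real) \<Rightarrow> channel_state \<Rightarrow> channel_state \<Rightarrow> real \<Rightarrow> real" where
  "channel_prob M D i j u =
     measure M {\<omega> \<in> space M. \<exists>n. period_state i n = j \<and>
       (\<Sum>k<n. D k \<omega>) \<le> u \<and> u < (\<Sum>k\<le>n. D k \<omega>)}"

end

theory Submission
  imports Defs
begin

text \<open>Let \<open>S\<^sub>n\<close> be the sum of the first \<open>n\<close> durations. By Tonelli, the transform of the probability of
  being in period \<open>n\<close> is \<open>(L\<^sub>n - L\<^sub>n\<^sub>+\<^sub>1) / s\<close> with \<open>L\<^sub>n = E (exp (- s * S\<^sub>n))\<close>. By independence \<open>L\<^sub>n\<close>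
  is a product of Laplace transforms, and summing over the periods of one parity gives a geometric
  series with ratio \<open>f\<^sub>X\<^sup>*(s) f\<^sub>Y\<^sup>*(s) < 1\<close>.\<close>

section \<open>Discounted occupation times of random time sets\<close>

lemma nn_integral_exp_atLeastAtMost:
  fixes a b s :: real
  assumes "s > 0" "a \<le> b"
  shows "(\<integral>\<^sup>+u. ennreal (exp (- s * u)) * indicator {a..b} u \<partial>lborel) =
           ennreal ((exp (- s * a) - exp (- s * b)) / s)"
proof -
  have "(\<integral>\<^sup>+u. ennreal (exp (- s * u)) * indicator {a..b} u \<partial>lborel) =
          ennreal (- exp (- s * b) / s - (- exp (- s * a) / s))"
    using assms by (intro nn_integral_FTC_Icc) (auto intro!: derivative_eq_intros)
  then show ?thesis
    by (simp add: diff_divide_distrib)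
qed

lemma nn_integral_exp_atLeastLessThan:
  fixes a b s :: real
  assumes "s > 0" "a \<le> b"
  shows "(\<integral>\<^sup>+u. ennreal (exp (- s * u)) * indicator {a..<b} u \<partial>lborel) =
           ennreal ((exp (- s * a) - exp (- s * b)) / s)"
proof -
  have "(\<integral>\<^sup>+u. ennreal (exp (- s * u)) * indicator {a..<b} u \<partial>lborel) =
          (\<integral>\<^sup>+u. ennreal (exp (- s * u)) * indicator {a..b} u \<partial>lborel)"
    by (rule nn_integral_cong_AE, rule AE_mp[OF AE_lborel_singleton[of b]])
       (auto split: split_indicator)
  then show ?thesis
    using nn_integral_exp_atLeastAtMost[OF assms] by simp
qed

text \<open>Tonelli: the probability is the \<open>Q\<close>-integral of an indicator, and
  exchanging the order of integration leaves, for each outcome, the exponentially weighted length of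
  a random set of times. Nonnegative integrals spare any integrability check: if the integral
  diverges, both sides are 0 by the conventions for the Bochner integral and
  \<open>enn2real\<close>.\<close>

lemma laplace_prob:
  assumes Q: "prob_space Q"
    and A: "Measurable.pred (lborel \<Otimes>\<^sub>M Q) (\<lambda>(u, \<omega>). A u \<omega>)"
  shows "laplace (\<lambda>u. measure Q {\<omega> \<in> space Q. A u \<omega>}) s =
           enn2real (\<integral>\<^sup>+\<omega>. (\<integral>\<^sup>+u. ennreal (exp (- s * u)) * indicator {u. 0 \<le> u \<and> A u \<omega>} u
             \<partial>lborel) \<partial>Q)"
proof -
  interpret prob_space Q by (fact Q)
  interpret P: pair_sigma_finite lborel Q ..
  note A[measurable]
  have sec[measurable]: "{\<omega> \<in> space Q. A u \<omega>} \<in> sets Q" for u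
    by measurable
  have set: "{x \<in> space (lborel \<Otimes>\<^sub>M Q). A (fst x) (snd x)} \<in> sets (lborel \<Otimes>\<^sub>M Q)"
    using A by (simp add: case_prod_beta' pred_def)
  \<comment> \<open>The event at time \<open>u\<close> is the section at \<open>u\<close> of a set
    measurable in the product, so its probability depends measurably on \<open>u\<close>.\<close>
  have "(\<lambda>u. emeasure Q (Pair u -` {x \<in> space (lborel \<Otimes>\<^sub>M Q). A (fst x) (snd x)}))
          \<in> borel_measurable lborel"
    by (rule measurable_emeasure_Pair[OF set])
  also have "(\<lambda>u. Pair u -` {x \<in> space (lborel \<Otimes>\<^sub>M Q). A (fst x) (snd x)}) =
               (\<lambda>u. {\<omega> \<in> space Q. A u \<omega>})"
    by (auto simp: space_pair_measure)
  finally have [measurable]: "(\<lambda>u. measure Q {\<omega> \<in> space Q. A u \<omega>}) \<in> borel_measurable borel"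
    unfolding measure_def by (simp add: comp_def)
  have "laplace (\<lambda>u. measure Q {\<omega> \<in> space Q. A u \<omega>}) s = enn2real (\<integral>\<^sup>+u.
      ennreal (indicator {0..} u *\<^sub>R (exp (- s * u) * measure Q {\<omega> \<in> space Q. A u \<omega>})) \<partial>lborel)"
    unfolding laplace_def set_lebesgue_integral_def
    by (intro integral_eq_nn_integral) auto
  also have "(\<integral>\<^sup>+u. ennreal (indicator {0..} u *\<^sub>R
                (exp (- s * u) * measure Q {\<omega> \<in> space Q. A u \<omega>})) \<partial>lborel) =
      (\<integral>\<^sup>+u. (\<integral>\<^sup>+\<omega>. ennreal (exp (- s * u)) * indicator {u. 0 \<le> u \<and> A u \<omega>} u \<partial>Q) \<partial>lborel)"
  proof (rule nn_integral_cong)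
    fix u :: real
    have "(\<integral>\<^sup>+\<omega>. ennreal (exp (- s * u)) * indicator {u. 0 \<le> u \<and> A u \<omega>} u \<partial>Q) =
        (\<integral>\<^sup>+\<omega>. ennreal (exp (- s * u)) * indicator {0..} u *
            indicator {\<omega> \<in> space Q. A u \<omega>} \<omega> \<partial>Q)"
      by (intro nn_integral_cong) (auto split: split_indicator)
    also have "\<dots> = ennreal (exp (- s * u)) * indicator {0..} u * emeasure Q {\<omega> \<in> space Q. A u \<omega>}"
      by (subst nn_integral_cmult_indicator) auto
    finally show "ennreal (indicator {0..} u *\<^sub>R
                (exp (- s * u) * measure Q {\<omega> \<in> space Q. A u \<omega>})) =
      (\<integral>\<^sup>+\<omega>. ennreal (exp (- s * u)) * indicator {u. 0 \<le> u \<and> A u \<omega>} u \<partial>Q)"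
      by (auto simp: emeasure_eq_measure ennreal_mult split: split_indicator)
  qed
  also have "\<dots> = (\<integral>\<^sup>+\<omega>. (\<integral>\<^sup>+u. ennreal (exp (- s * u)) * indicator {u. 0 \<le> u \<and> A u \<omega>} u
                     \<partial>lborel) \<partial>Q)"
    by (rule P.Fubini'[symmetric]) (simp add: indicator_def)
  finally show ?thesis .
qed

text \<open>For a fixed outcome the periods selected by \<open>\<nu>\<close> occupy disjoint
  half-open intervals, so the weight of their union is a series of differences of exponentials. Its
  terms are nonnegative, hence expectations may be taken termwise. What remains is the numerical
  series in \<open>c\<close>, to be evaluated later by independence; \<open>\<nu>\<close> will
  enumerate the odd or the even periods.\<close>

lemma laplace_occupation:
  fixes \<nu> :: "nat \<Rightarrow> nat"
  assumes M: "prob_space M"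
    and D[measurable]: "\<And>k. D k \<in> borel_measurable M"
    and D0: "AE \<omega> in M. \<forall>k. 0 \<le> D k \<omega>"
    and "s > 0" and \<nu>: "strict_mono \<nu>"
    and c: "(\<lambda>m. ((LINT \<omega>|M. exp (- s * (\<Sum>k<\<nu> m. D k \<omega>))) -
                 (LINT \<omega>|M. exp (- s * (\<Sum>k\<le>\<nu> m. D k \<omega>)))) / s) sums c"
  shows "laplace (\<lambda>u. measure M {\<omega> \<in> space M.
            \<exists>m. (\<Sum>k<\<nu> m. D k \<omega>) \<le> u \<and> u < (\<Sum>k\<le>\<nu> m. D k \<omega>)}) s = c"
proof -
  interpret prob_space M by (fact M)
  let ?e = "\<lambda>m \<omega>. (exp (- s * (\<Sum>k<\<nu> m. D k \<omega>)) - exp (- s * (\<Sum>k\<le>\<nu> m. D k \<omega>))) / s"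
  have int: "integrable M (\<lambda>\<omega>. exp (- s * (\<Sum>k\<in>K. D k \<omega>)))" for K
  proof (rule integrable_const_bound[where B = 1])
    show "AE \<omega> in M. norm (exp (- s * (\<Sum>k\<in>K. D k \<omega>))) \<le> 1"
      using D0 by eventually_elim (use \<open>s > 0\<close> in \<open>simp add: sum_nonneg\<close>)
  qed simp
  have inner: "AE \<omega> in M. (\<integral>\<^sup>+u. ennreal (exp (- s * u)) * indicator {u. 0 \<le> u \<and>
        (\<exists>m. (\<Sum>k<\<nu> m. D k \<omega>) \<le> u \<and> u < (\<Sum>k\<le>\<nu> m. D k \<omega>))} u \<partial>lborel) =
        (\<Sum>m. ennreal (?e m \<omega>))"
    using D0
  proof eventually_elim
    case (elim \<omega>)
    define I where "I m = {\<Sum>k<\<nu> m. D k \<omega> ..< \<Sum>k\<le>\<nu> m. D k \<omega>}" for m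
    have mono: "(\<Sum>k\<le>\<nu> i. D k \<omega>) \<le> (\<Sum>k<\<nu> j. D k \<omega>)" if "i < j" for i j
      using elim strict_monoD[OF \<nu> that] by (intro sum_mono2) auto
    have "disjoint_family I"
      unfolding disjoint_family_on_def
    proof (intro ballI impI)
      fix i j :: nat assume "i \<noteq> j"
      then show "I i \<inter> I j = {}"
        using mono[of i j] mono[of j i] by (cases "i < j") (auto simp: I_def)
    qed
    have Sk: "(\<Sum>k<\<nu> m. D k \<omega>) \<le> (\<Sum>k\<le>\<nu> m. D k \<omega>)" for m
      using elim by (intro sum_mono2) auto
    \<comment> \<open>The constraint \<open>0 \<le> u\<close> disappears because every interval
      starts at a sum of nonnegative durations.\<close>
    have "{u. 0 \<le> u \<and> (\<exists>m. (\<Sum>k<\<nu> m. D k \<omega>) \<le> u \<and> u < (\<Sum>k\<le>\<nu> m. D k \<omega>))} = (\<Union>m. I m)"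
      using elim by (auto simp: I_def intro: order_trans[OF sum_nonneg])
    then have "(\<integral>\<^sup>+u. ennreal (exp (- s * u)) * indicator {u. 0 \<le> u \<and>
        (\<exists>m. (\<Sum>k<\<nu> m. D k \<omega>) \<le> u \<and> u < (\<Sum>k\<le>\<nu> m. D k \<omega>))} u \<partial>lborel) =
        (\<integral>\<^sup>+u. (\<Sum>m. ennreal (exp (- s * u)) * indicator (I m) u) \<partial>lborel)"
      by (simp add: suminf_indicator[OF \<open>disjoint_family I\<close>, symmetric])
    also have "\<dots> = (\<Sum>m. \<integral>\<^sup>+u. ennreal (exp (- s * u)) * indicator (I m) u \<partial>lborel)"
      by (rule nn_integral_suminf) (simp add: I_def)
    also have "\<dots> = (\<Sum>m. ennreal (?e m \<omega>))"
      unfolding I_def by (simp only: nn_integral_exp_atLeastLessThan[OF \<open>s > 0\<close> Sk])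
    finally show ?case .
  qed
  have e_nonneg: "AE \<omega> in M. 0 \<le> ?e m \<omega>" for m
    using D0
  proof eventually_elim
    case (elim \<omega>)
    have "(\<Sum>k<\<nu> m. D k \<omega>) \<le> (\<Sum>k\<le>\<nu> m. D k \<omega>)"
      using elim by (intro sum_mono2) auto
    then show ?case
      using \<open>s > 0\<close> by simp
  qed
  have e_int: "integral\<^sup>L M (?e m) = ((LINT \<omega>|M. exp (- s * (\<Sum>k<\<nu> m. D k \<omega>))) -
                 (LINT \<omega>|M. exp (- s * (\<Sum>k\<le>\<nu> m. D k \<omega>)))) / s" for m
    using int by simp
  have nonneg: "0 \<le> integral\<^sup>L M (?e m)" for m
    by (rule integral_nonneg_AE[OF e_nonneg])
  have sums: "(\<lambda>m. integral\<^sup>L M (?e m)) sums c"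
    using c unfolding e_int .
  have "laplace (\<lambda>u. measure M {\<omega> \<in> space M.
            \<exists>m. (\<Sum>k<\<nu> m. D k \<omega>) \<le> u \<and> u < (\<Sum>k\<le>\<nu> m. D k \<omega>)}) s =
        enn2real (\<integral>\<^sup>+\<omega>. (\<Sum>m. ennreal (?e m \<omega>)) \<partial>M)"
    unfolding nn_integral_cong_AE[OF inner, symmetric]
    by (rule laplace_prob[OF M]) measurable
  also have "(\<integral>\<^sup>+\<omega>. (\<Sum>m. ennreal (?e m \<omega>)) \<partial>M) = (\<Sum>m. \<integral>\<^sup>+\<omega>. ennreal (?e m \<omega>) \<partial>M)"
    by (rule nn_integral_suminf) measurable
  also have "\<dots> = (\<Sum>m. ennreal (integral\<^sup>L M (?e m)))"
    using int by (intro suminf_cong nn_integral_eq_integral e_nonneg) auto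
  also have "\<dots> = ennreal c"
    by (rule suminf_ennreal_eq[OF nonneg sums])
  \<comment> \<open>\<open>enn2real (ennreal c)\<close> equals \<open>c\<close> only for nonnegative
    \<open>c\<close>; the sign comes from the terms of the series.\<close>
  finally show ?thesis
    using sums_le[OF nonneg sums_zero sums] by simp
qed

section \<open>Laplace transforms of densities and of residual densities\<close>

lemma pos_densityD:
  assumes "pos_density f"
  shows "0 \<le> f x" "x \<le> 0 \<Longrightarrow> f x = 0" "f \<in> borel_measurable borel"
    "integrable lborel f" "integral\<^sup>L lborel f = 1"
  using assms unfolding pos_density_def has_bochner_integral_iff by auto

lemma prob_space_pos_density:
  assumes "pos_density f"
  shows "prob_space (density lborel (\<lambda>t. ennreal (f t)))"
proof
  have "emeasure (density lborel (\<lambda>t. ennreal (f t))) UNIV = (\<integral>\<^sup>+t. ennreal (f t) \<partial>lborel)"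
    using pos_densityD(3)[OF assms] by (simp add: emeasure_density)
  also have "\<dots> = 1"
    using pos_densityD[OF assms] by (subst nn_integral_eq_integral) auto
  finally show "emeasure (density lborel (\<lambda>t. ennreal (f t)))
      (space (density lborel (\<lambda>t. ennreal (f t)))) = 1"
    by simp
qed

text \<open>Gives the transform the shape of an integral over the whole line with the density as
  first factor, which matches the library rules for integrals against a density.\<close>

lemma laplace_eq_integral:
  assumes "\<And>x. x \<le> 0 \<Longrightarrow> f x = 0"
  shows "laplace f s = (LINT t|lborel. f t * exp (- s * t))"
  unfolding laplace_def set_lebesgue_integral_def
  using assms by (intro Bochner_Integration.integral_cong) (auto split: split_indicator)

lemma laplace_pos_density:
  assumes "pos_density f"
  shows "laplace f s = (LINT t|lborel. f t * exp (- s * t))"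
  by (rule laplace_eq_integral) (rule pos_densityD(2)[OF assms])

lemma integrable_exp_pos_density:
  assumes "pos_density f" "s > 0"
  shows "integrable lborel (\<lambda>t. f t * exp (- s * t))"
proof (rule Bochner_Integration.integrable_bound[OF pos_densityD(4)[OF assms(1)]])
  note pos_densityD(3)[OF assms(1), measurable]
  show "(\<lambda>t. f t * exp (- s * t)) \<in> borel_measurable lborel"
    by measurable
  have "norm (f t * exp (- s * t)) \<le> norm (f t)" for t
  proof (cases "t \<le> 0")
    case False
    then have "\<bar>f t\<bar> * exp (- s * t) \<le> \<bar>f t\<bar> * 1"
      using assms(2) by (intro mult_left_mono) auto
    then show ?thesis by (simp add: abs_mult)
  qed (simp add: pos_densityD(2)[OF assms(1)])
  then show "AE t in lborel. norm (f t * exp (- s * t)) \<le> norm (f t)"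
    by simp
qed

lemma laplace_pos_density_nonneg:
  assumes "pos_density f"
  shows "0 \<le> laplace f s"
  unfolding laplace_pos_density[OF assms]
  using pos_densityD(1)[OF assms] by (intro integral_nonneg_AE) simp

text \<open>The gap \<open>1 - laplace f s\<close> is the integral of the nonnegative function
  \<open>?d\<close>. Were it 0, \<open>f\<close> would vanish almost everywhere, against its total
  mass 1. Strictness is what makes the geometric series over the periods converge.\<close>

lemma laplace_pos_density_less_1:
  assumes "pos_density f" "s > 0"
  shows "laplace f s < 1"
proof -
  note f = pos_densityD[OF assms(1)]
  let ?d = "\<lambda>t. f t * (1 - exp (- s * t))"
  have int: "integrable lborel ?d"
    using f(4) integrable_exp_pos_density[OF assms] by (simp add: right_diff_distrib)
  have "integral\<^sup>L lborel ?d = 1 - laplace f s"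
    unfolding laplace_pos_density[OF assms(1)]
    using f(4,5) integrable_exp_pos_density[OF assms] by (simp add: right_diff_distrib)
  moreover have d0: "0 \<le> ?d t" for t
    using f(1)[of t] f(2)[of t] assms(2) by (cases "t \<le> 0") auto
  then have "0 \<le> integral\<^sup>L lborel ?d"
    by (intro integral_nonneg_AE) simp
  moreover have "integral\<^sup>L lborel ?d \<noteq> 0"
  proof
    assume "integral\<^sup>L lborel ?d = 0"
    then have "AE t in lborel. ?d t = 0"
      using integral_nonneg_eq_0_iff_AE[OF int] d0 by simp
    \<comment> \<open>The factor \<open>1 - exp (- s * t)\<close> is positive for
      \<open>t > 0\<close>, and \<open>f\<close> is 0 elsewhere.\<close>
    then have "AE t in lborel. f t = 0"
    proof eventually_elim
      case (elim t)
      then show ?case using f(2)[of t] assms(2) by (cases "t \<le> 0") auto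
    qed
    then have "integral\<^sup>L lborel f = 0"
      using f(3) by (subst integral_cong_AE[where g = "\<lambda>_. 0"]) auto
    then show False using f(5) by simp
  qed
  ultimately show ?thesis by linarith
qed

lemma mean_pos_density_nonneg:
  assumes "pos_density f"
  shows "0 \<le> mean f"
  unfolding mean_def set_lebesgue_integral_def
  using pos_densityD(1)[OF assms]
  by (intro integral_nonneg_AE) (auto split: split_indicator)

text \<open>The numerator of the residual density is a tail probability under the law
  \<open>?Q\<close> with density \<open>f\<close>. So \<open>laplace_prob\<close> turns its
  transform into the \<open>?Q\<close>-expectation of the integral of \<open>exp (- s * u)\<close>
  over \<open>u\<close> from 0 to \<open>y\<close>, which is
  \<open>(1 - exp (- s * y)) / s\<close>.\<close>

lemma laplace_residual_density:
  assumes "pos_density f" "s > 0"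
  shows "laplace (residual_density f) s = (1 - laplace f s) / (s * mean f)"
proof -
  note f = pos_densityD[OF assms(1)]
  note f(3)[measurable]
  let ?Q = "density lborel (\<lambda>t. ennreal (f t))"
  interpret Q: prob_space ?Q
    by (rule prob_space_pos_density[OF assms(1)])
  have int: "integrable ?Q (\<lambda>t. exp (- s * t))"
    using integrable_exp_pos_density[OF assms] f(1)
    by (subst integrable_density) auto
  have pos: "AE y in ?Q. 0 \<le> y"
    using f(2) by (subst AE_density) (auto intro!: AE_I2 leI)
  \<comment> \<open>The condition \<open>0 < u\<close> reproduces the value 0 of
    \<open>residual_density\<close> at nonpositive arguments. The single point 0 that it removes
    from the interval up to \<open>y\<close> is a null set.\<close>
  let ?P = "\<lambda>u. measure ?Q {y \<in> space ?Q. 0 < u \<and> u \<le> y}"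
  have "residual_density f = (\<lambda>u. ?P u / mean f)"
    by (auto simp: residual_density_def fun_eq_iff atLeast_def)
  then have "laplace (residual_density f) s = laplace ?P s / mean f"
    by (simp add: laplace_def)
  also have "laplace ?P s =
      enn2real (\<integral>\<^sup>+y. (\<integral>\<^sup>+u. ennreal (exp (- s * u)) *
        indicator {u. 0 \<le> u \<and> 0 < u \<and> u \<le> y} u \<partial>lborel) \<partial>?Q)"
    by (rule laplace_prob[OF Q.prob_space_axioms]) measurable
  also have "(\<integral>\<^sup>+y. (\<integral>\<^sup>+u. ennreal (exp (- s * u)) *
        indicator {u. 0 \<le> u \<and> 0 < u \<and> u \<le> y} u \<partial>lborel) \<partial>?Q) =
      (\<integral>\<^sup>+y. ennreal ((1 - exp (- s * y)) / s) \<partial>?Q)"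
  proof (rule nn_integral_cong_AE)
    show "AE y in ?Q. (\<integral>\<^sup>+u. ennreal (exp (- s * u)) *
        indicator {u. 0 \<le> u \<and> 0 < u \<and> u \<le> y} u \<partial>lborel) = ennreal ((1 - exp (- s * y)) / s)"
      using pos
    proof eventually_elim
      case (elim y)
      have "(\<integral>\<^sup>+u. ennreal (exp (- s * u)) *
          indicator {u. 0 \<le> u \<and> 0 < u \<and> u \<le> y} u \<partial>lborel) =
          (\<integral>\<^sup>+u. ennreal (exp (- s * u)) * indicator {0..y} u \<partial>lborel)"
        by (rule nn_integral_cong_AE, rule AE_mp[OF AE_lborel_singleton[of 0]])
           (auto split: split_indicator)
      then show ?case
        using nn_integral_exp_atLeastAtMost[OF assms(2) elim] by simp
    qed
  qed
  also have "\<dots> = ennreal (LINT y|?Q. (1 - exp (- s * y)) / s)"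
    using int pos assms(2)
    by (intro nn_integral_eq_integral) (auto elim!: eventually_mono)
  also have "enn2real \<dots> = (LINT y|?Q. (1 - exp (- s * y)) / s)"
    using pos assms(2)
    by (intro enn2real_ennreal integral_nonneg_AE) (auto elim!: eventually_mono)
  also have "\<dots> = (1 - (LINT y|?Q. exp (- s * y))) / s"
    using int Q.prob_space by simp
  also have "(LINT y|?Q. exp (- s * y)) = laplace f s"
    unfolding laplace_pos_density[OF assms(1)]
    using f(1) by (subst integral_density) auto
  finally show ?thesis
    by (simp add: field_simps)
qed

section \<open>The alternating sequence of durations and the channel probabilities\<close>

lemma distributed_expectation_exp:
  assumes "distributed M lborel X (\<lambda>x. ennreal (h x))"
    and "\<And>x. 0 \<le> h x" "\<And>x. x \<le> 0 \<Longrightarrow> h x = 0"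
  shows "(LINT \<omega>|M. exp (- s * X \<omega>)) = laplace h s"
proof -
  have "(LINT \<omega>|M. exp (- s * X \<omega>)) = (LINT x|lborel. h x * exp (- s * x))"
    by (rule distributed_integral[OF assms(1), symmetric]) (auto simp: assms(2))
  then show ?thesis
    by (simp add: laplace_eq_integral[of h, OF assms(3)])
qed

lemma distributed_AE_pos:
  fixes X :: "'a \<Rightarrow> real"
  assumes "distributed M lborel X (\<lambda>x. ennreal (h x))"
    and "\<And>x. x \<le> 0 \<Longrightarrow> h x = 0"
  shows "AE \<omega> in M. 0 < X \<omega>"
proof -
  have "AE x in distr M lborel X. 0 < x"
    unfolding distributed_distr_eq_density[OF assms(1)]
    using assms(2) distributed_borel_measurable[OF assms(1)]
    by (subst AE_density) (auto intro!: AE_I2 simp: not_le[symmetric])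
  then show ?thesis
    by (subst (asm) AE_distr_iff) (use distributed_measurable[OF assms(1)] in auto)
qed

text \<open>Replaces the condition on the state by an enumeration of the periods in that state, the
  form that \<open>laplace_occupation\<close> handles.\<close>

lemma channel_prob_cong:
  assumes "\<And>n. period_state i n = j \<longleftrightarrow> n \<in> range \<nu>"
  shows "channel_prob M D i j = (\<lambda>u. measure M {\<omega> \<in> space M.
           \<exists>m. (\<Sum>k<\<nu> m. D k \<omega>) \<le> u \<and> u < (\<Sum>k\<le>\<nu> m. D k \<omega>)})"
  unfolding channel_prob_def assms by (rule ext) (auto intro!: arg_cong[where f = "measure M"])

text \<open>Covers both sensing situations: \<open>f\<close> belongs to the state found at sensing,
  \<open>g\<close> to the other one. Even and odd periods are summed separately as geometric series
  with ratio \<open>F * G\<close>, and the two values turn out to add up to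
  \<open>1 / s\<close>.\<close>

lemma laplace_channel_prob:
  assumes f: "pos_density f" and g: "pos_density g"
    and alt: "alternating_durations M D f g" and "s > 0"
  defines "L \<equiv> (1 - laplace f s) * (1 - laplace g s) /
                (s\<^sup>2 * mean f * (1 - laplace f s * laplace g s))"
  shows "laplace (channel_prob M D i i) s = 1 / s - L"
    and "laplace (channel_prob M D i (opposite i)) s = L"
proof -
  let ?r = "residual_density f"
  define F where "F = laplace f s"
  define G where "G = laplace g s"
  define R where "R = laplace ?r s"
  from alt have M: "prob_space M" and ind: "prob_space.indep_vars M (\<lambda>_. borel) D UNIV"
    and d0: "distributed M lborel (D 0) (\<lambda>x. ennreal (?r x))"
    and dg: "\<And>n. distributed M lborel (D (2 * n + 1)) (\<lambda>x. ennreal (g x))"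
    and df: "\<And>n. distributed M lborel (D (2 * n + 2)) (\<lambda>x. ennreal (f x))"
    unfolding alternating_durations_def by auto
  interpret prob_space M by (fact M)
  have D[measurable]: "D k \<in> borel_measurable M" for k
    using ind unfolding indep_vars_def by simp
  have r: "0 \<le> ?r x" "x \<le> 0 \<Longrightarrow> ?r x = 0" for x
    using mean_pos_density_nonneg[OF f] by (auto simp: residual_density_def)
  \<comment> \<open>One family of densities for all durations, so that the product formula needs no
    distinction of cases.\<close>
  define h where "h k = (if k = 0 then ?r else if odd k then g else f)" for k :: nat
  have h: "0 \<le> h k x" "x \<le> 0 \<Longrightarrow> h k x = 0" for k x
    using r pos_densityD(1,2)[OF f] pos_densityD(1,2)[OF g] by (auto simp: h_def)
  have dh: "distributed M lborel (D k) (\<lambda>x. ennreal (h k x))" for k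
  proof -
    consider "k = 0" | n where "k = 2 * n + 1" | n where "k = 2 * n + 2"
      by (metis evenE oddE add_2_eq_Suc' mult_Suc_right not0_implies_Suc mult_0_right add.commute)
    then show ?thesis
      by cases (use d0 dg df in \<open>auto simp: h_def\<close>)
  qed
  have D0: "AE \<omega> in M. \<forall>k. 0 \<le> D k \<omega>"
  proof (subst AE_all_countable, rule allI)
    fix k
    have "AE \<omega> in M. 0 < D k \<omega>"
      by (rule distributed_AE_pos[OF dh]) (rule h(2))
    then show "AE \<omega> in M. 0 \<le> D k \<omega>"
      by eventually_elim simp
  qed
  \<comment> \<open>The exponential of a sum is a product of functions of the single durations, and
    independence makes its expectation a product of Laplace transforms.\<close>
  have prod: "(LINT \<omega>|M. exp (- s * (\<Sum>k<n. D k \<omega>))) = (\<Prod>k<n. laplace (h k) s)" for n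
  proof -
    have ind': "indep_vars (\<lambda>_. borel) (\<lambda>k \<omega>. exp (- s * D k \<omega>)) {..<n}"
      by (rule indep_vars_compose2[OF indep_vars_subset[OF ind]]) auto
    have int: "integrable M (\<lambda>\<omega>. exp (- s * D k \<omega>))" for k
    proof (rule integrable_const_bound[where B = 1])
      show "AE \<omega> in M. norm (exp (- s * D k \<omega>)) \<le> 1"
        using D0 by eventually_elim (use \<open>s > 0\<close> in simp)
    qed simp
    have "(LINT \<omega>|M. exp (- s * (\<Sum>k<n. D k \<omega>))) = (LINT \<omega>|M. (\<Prod>k<n. exp (- s * D k \<omega>)))"
      by (simp add: sum_distrib_left exp_sum sum_negf[symmetric])
    also have "\<dots> = (\<Prod>k<n. LINT \<omega>|M. exp (- s * D k \<omega>))"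
      using indep_vars_lebesgue_integral[OF _ ind' int] by simp
    also have "\<dots> = (\<Prod>k<n. laplace (h k) s)"
      by (simp only: distributed_expectation_exp[OF dh h])
    finally show ?thesis .
  qed
  \<comment> \<open>The first \<open>2 * m + 1\<close> durations are the residual one, giving
    \<open>R\<close>, and \<open>m\<close> pairs with densities \<open>g\<close> and
    \<open>f\<close>. The next one has odd index and contributes \<open>G\<close>.\<close>
  have odd: "(\<Prod>k<2 * m + 1. laplace (h k) s) = R * (F * G) ^ m" for m
    by (induction m) (simp_all add: h_def R_def F_def G_def)
  have even: "(\<Prod>k<2 * m + 2. laplace (h k) s) = R * (F * G) ^ m * G" for m
    using odd[of m] by (simp add: h_def G_def)
  have FG: "0 \<le> F" "F < 1" "0 \<le> G" "G < 1"
    using laplace_pos_density_nonneg laplace_pos_density_less_1 f g \<open>s > 0\<close>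
    by (auto simp: F_def G_def)
  have "F * G < 1"
    using mult_mono[of F F G 1] FG by simp
  have geo: "(\<lambda>m. a * (F * G) ^ m) sums (a / (1 - F * G))" for a
    using sums_mult[OF geometric_sums[of "F * G"], of a] FG \<open>F * G < 1\<close> by simp
  have R: "R = (1 - F) / (s * mean f)"
    unfolding R_def F_def by (rule laplace_residual_density[OF f \<open>s > 0\<close>])
  have L: "L = R * (1 - G) / s / (1 - F * G)"
    unfolding L_def R F_def G_def by (simp add: power2_eq_square mult_ac)
  note occ = laplace_occupation[OF M D D0 \<open>s > 0\<close>]
  show "laplace (channel_prob M D i (opposite i)) s = L"
  proof -
    have p: "period_state i n = opposite i \<longleftrightarrow> n \<in> range (\<lambda>m. 2 * m + 1)" for n
      by (cases i) (auto simp: period_state_def elim: oddE)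
    show ?thesis
      unfolding channel_prob_cong[OF p]
    proof (rule occ)
      show "strict_mono (\<lambda>m::nat. 2 * m + 1)"
        by (simp add: strict_mono_def)
      \<comment> \<open>Period \<open>2 * m + 1\<close> starts with the product
        \<open>R * (F * G) ^ m\<close> and ends with one more factor \<open>G\<close>.\<close>
      have "(\<lambda>m. R * (1 - G) / s * (F * G) ^ m) sums L"
        unfolding L by (rule geo)
      moreover have "R * (1 - G) / s * (F * G) ^ m =
          ((\<Prod>k<2 * m + 1. laplace (h k) s) - (\<Prod>k<Suc (2 * m + 1). laplace (h k) s)) / s" for m
        using odd[of m] even[of m] by (simp add: algebra_simps)
      ultimately show "(\<lambda>m. ((LINT \<omega>|M. exp (- s * (\<Sum>k<2 * m + 1. D k \<omega>))) -
                 (LINT \<omega>|M. exp (- s * (\<Sum>k\<le>2 * m + 1. D k \<omega>)))) / s) sums L"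
        unfolding lessThan_Suc_atMost[symmetric] prod by (simp only:)
    qed
  qed
  show "laplace (channel_prob M D i i) s = 1 / s - L"
  proof -
    have p: "period_state i n = i \<longleftrightarrow> n \<in> range (\<lambda>m. 2 * m)" for n
      by (cases i) (auto simp: period_state_def elim: evenE)
    show ?thesis
      unfolding channel_prob_cong[OF p]
    proof (rule occ)
      show "strict_mono (\<lambda>m::nat. 2 * m)"
        by (simp add: strict_mono_def)
      let ?t = "\<lambda>m. ((\<Prod>k<2 * m. laplace (h k) s) - (\<Prod>k<Suc (2 * m). laplace (h k) s)) / s"
      \<comment> \<open>The even terms are geometric only from period 2 on: period 0 starts from the
        empty product 1 and has the residual density, so \<open>?t 0\<close> is added separately
        below.\<close>
      have "?t (Suc m) = R * G * (1 - F) / s * (F * G) ^ m" for m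
      proof -
        have "(\<Prod>k<2 * Suc m. laplace (h k) s) = R * (F * G) ^ m * G"
          using even[of m] by simp
        moreover have "(\<Prod>k<Suc (2 * Suc m). laplace (h k) s) = R * (F * G) ^ Suc m"
          using odd[of "Suc m"] by (simp only: Suc_eq_plus1)
        ultimately show ?thesis
          by (simp only:) (simp add: algebra_simps)
      qed
      then have "(\<lambda>m. ?t (Suc m)) sums (R * G * (1 - F) / s / (1 - F * G))"
        using geo[of "R * G * (1 - F) / s"] by (simp only:)
      then have "?t sums (R * G * (1 - F) / s / (1 - F * G) + ?t 0)"
        by (rule sums_Suc)
      moreover have "?t 0 = (1 - R) / s"
        using odd[of 0] by simp
      \<comment> \<open>After clearing denominators this rests on
        \<open>(1 - F * G) - G * (1 - F) = 1 - G\<close>.\<close>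
      moreover have "R * G * (1 - F) / s / (1 - F * G) + (1 - R) / s = 1 / s - L"
        unfolding L using \<open>F * G < 1\<close> \<open>s > 0\<close> by (simp add: divide_simps) (simp add: algebra_simps)
      ultimately show "(\<lambda>m. ((LINT \<omega>|M. exp (- s * (\<Sum>k<2 * m. D k \<omega>))) -
                 (LINT \<omega>|M. exp (- s * (\<Sum>k\<le>2 * m. D k \<omega>)))) / s) sums (1 / s - L)"
        unfolding lessThan_Suc_atMost[symmetric] prod by (simp only:)
    qed
  qed
qed

theorem mainTheorem2:
  fixes fX fY :: "real \<Rightarrow> real"
    and M :: "'a measure" and D :: "nat \<Rightarrow> 'a \<Rightarrow> real"
    and N :: "'b measure" and E :: "nat \<Rightarrow> 'b \<Rightarrow> real"
    and s :: real
  assumes "pos_density fX" and "pos_density fY"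
    and "finite_mean fX" and "finite_mean fY"
    and off_sensed: "alternating_durations M D fY fX"
    and on_sensed: "alternating_durations N E fX fY"
    and "s > 0"
  shows "laplace (channel_prob M D OFF OFF) s =
           1 / s - (1 - laplace fY s) * (1 - laplace fX s) /
                     (s\<^sup>2 * mean fY * (1 - laplace fX s * laplace fY s))
    \<and> laplace (channel_prob N E ON ON) s =
           1 / s - (1 - laplace fY s) * (1 - laplace fX s) /
                     (s\<^sup>2 * mean fX * (1 - laplace fX s * laplace fY s))
    \<and> laplace (channel_prob N E ON OFF) s = 1 / s - laplace (channel_prob N E ON ON) s"
  \<comment> \<open>The roles of \<open>fX\<close> and \<open>fY\<close> are exchanged between the
    two instances. The last conjunct holds because, for \<open>i = ON\<close>, the two transforms
    are \<open>L\<close> and \<open>1 / s - L\<close>.\<close>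
  using laplace_channel_prob[OF assms(2,1) off_sensed \<open>s > 0\<close>, of OFF]
    laplace_channel_prob[OF assms(1,2) on_sensed \<open>s > 0\<close>, of ON]
  by (simp add: mult_ac)

end
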